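(* Let $n\ge 2$ be an integer with prime-power factorization $n=\prod_{k=1}^t p_k^{e_k}$ (distinct primes $p_k$, exponents $e_k\ge 1$). The following are equivalent. (1) $\mathrm{AGL}_1(\mathbb{Z}/n\mathbb{Z})$ contains a cross-commuting nonabelian square. (2) At least two of the prime-power factors $p_k^{e_k}$ are greater than $2$. (3) $n$ is neither a prime power nor twice an odd prime power.
   Context: For a commutative ring $R$ with identity, $\mathrm{AGL}_1(R)$ is the group (under composition) of affine permutations $x\mapsto ax+b$ of $R$ with $a\in R^\times$ and $b\in R$; identifying such a map with the pair $(a,b)$, the composition law is $(a,b)\circ(c,d)=(ac,ad+b)$. A cross-commuting nonabelian square in $\mathrm{AGL}_1(R)$ is a quadruple $(F_0,F_1,G_0,G_1)$ of elements of $\mathrm{AGL}_1(R)$ such that $F_i$ commutes with $G_j$ for all $i,j\in\{0,1\}$, but $F_0$ and $F_1$ do not commute, and $G_0$ and $G_1$ do not commute. A prime power means $p^e$ with $p$ prime and $e\ge 1$. *)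

theory Defs
  imports "HOL-Number_Theory.Number_Theory" "HOL-Algebra.Bij"
begin

definition affine_map :: "('a, 'b) ring_scheme \<Rightarrow> 'a \<Rightarrow> 'a \<Rightarrow> 'a \<Rightarrow> 'a" where
  "affine_map R a b = (\<lambda>x \<in> carrier R. (a \<otimes>\<^bsub>R\<^esub> x) \<oplus>\<^bsub>R\<^esub> b)"

definition AGL1 :: "('a, 'b) ring_scheme \<Rightarrow> ('a \<Rightarrow> 'a) monoid" where
  "AGL1 R = BijGroup (carrier R)
     \<lparr>carrier := {affine_map R a b | a b. a \<in> Units R \<and> b \<in> carrier R}\<rparr>"

definition cross_commuting_nonabelian_square ::
    "('g, 'b) monoid_scheme \<Rightarrow> 'g \<times> 'g \<times> 'g \<times> 'g \<Rightarrow> bool" where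
  "cross_commuting_nonabelian_square G = (\<lambda>(F0, F1, G0, G1).
     {F0, F1, G0, G1} \<subseteq> carrier G \<and>
     (\<forall>F \<in> {F0, F1}. \<forall>H \<in> {G0, G1}. F \<otimes>\<^bsub>G\<^esub> H = H \<otimes>\<^bsub>G\<^esub> F) \<and>
     F0 \<otimes>\<^bsub>G\<^esub> F1 \<noteq> F1 \<otimes>\<^bsub>G\<^esub> F0 \<and>
     G0 \<otimes>\<^bsub>G\<^esub> G1 \<noteq> G1 \<otimes>\<^bsub>G\<^esub> G0)"

lemma (in cring) affine_map_compose:
  assumes "a \<in> carrier R" "b \<in> carrier R" "c \<in> carrier R" "d \<in> carrier R"
  shows "compose (carrier R) (affine_map R a b) (affine_map R c d) =
    affine_map R (a \<otimes> c) (a \<otimes> d \<oplus> b)"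
  using assms by (auto simp: compose_def affine_map_def fun_eq_iff r_distr m_assoc a_assoc)

lemma (in cring) affine_map_one_zero: "affine_map R \<one> \<zero> = (\<lambda>x \<in> carrier R. x)"
  by (auto simp: affine_map_def fun_eq_iff)

lemma (in cring) affine_map_inverse:
  assumes "a \<in> Units R" "b \<in> carrier R"
  shows "compose (carrier R) (affine_map R (inv a) (\<ominus> (inv a \<otimes> b))) (affine_map R a b) =
           affine_map R \<one> \<zero>"
    and "compose (carrier R) (affine_map R a b) (affine_map R (inv a) (\<ominus> (inv a \<otimes> b))) =
           affine_map R \<one> \<zero>"
proof -
  have "a \<otimes> (\<ominus> (inv a \<otimes> b)) = \<ominus> b"
    using assms by (simp add: Units_closed r_minus flip: m_assoc)
  then show "compose (carrier R) (affine_map R (inv a) (\<ominus> (inv a \<otimes> b))) (affine_map R a b) =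
           affine_map R \<one> \<zero>"
    and "compose (carrier R) (affine_map R a b) (affine_map R (inv a) (\<ominus> (inv a \<otimes> b))) =
           affine_map R \<one> \<zero>"
    using assms by (simp_all add: affine_map_compose Units_closed r_neg l_neg)
qed

lemma (in cring) affine_map_in_Bij:
  assumes "a \<in> Units R" "b \<in> carrier R"
  shows "affine_map R a b \<in> Bij (carrier R)"
proof -
  let ?f = "affine_map R a b" and ?g = "affine_map R (inv a) (\<ominus> (inv a \<otimes> b))"
  have "bij_betw ?f (carrier R) (carrier R)"
  proof (rule bij_betw_byWitness [where f' = ?g])
    show "\<forall>x\<in>carrier R. ?g (?f x) = x"
      using fun_cong [OF affine_map_inverse(1) [OF assms]]
      by (metis affine_map_one_zero compose_eq restrict_apply')
    show "\<forall>x\<in>carrier R. ?f (?g x) = x"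
      using fun_cong [OF affine_map_inverse(2) [OF assms]]
      by (metis affine_map_one_zero compose_eq restrict_apply')
  qed (use assms in \<open>auto simp: affine_map_def\<close>)
  then show ?thesis
    by (simp add: Bij_def affine_map_def)
qed

lemma (in cring) AGL1_mult:
  assumes "a \<in> Units R" "b \<in> carrier R" "c \<in> Units R" "d \<in> carrier R"
  shows "affine_map R a b \<otimes>\<^bsub>AGL1 R\<^esub> affine_map R c d = affine_map R (a \<otimes> c) (a \<otimes> d \<oplus> b)"
  using assms by (simp add: AGL1_def BijGroup_def affine_map_in_Bij affine_map_compose Units_closed)

lemma (in cring) group_AGL1: "group (AGL1 R)"
proof (rule groupI)
  have car: "carrier (AGL1 R) = {affine_map R a b | a b. a \<in> Units R \<and> b \<in> carrier R}"
    and one: "\<one>\<^bsub>AGL1 R\<^esub> = affine_map R \<one> \<zero>"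
    by (simp_all add: AGL1_def BijGroup_def affine_map_one_zero)
  show "\<one>\<^bsub>AGL1 R\<^esub> \<in> carrier (AGL1 R)"
    unfolding car one by blast
  show "x \<otimes>\<^bsub>AGL1 R\<^esub> y \<in> carrier (AGL1 R)"
    if "x \<in> carrier (AGL1 R)" "y \<in> carrier (AGL1 R)" for x y
  proof -
    from that obtain a b c d where
      "x = affine_map R a b" "a \<in> Units R" "b \<in> carrier R"
      "y = affine_map R c d" "c \<in> Units R" "d \<in> carrier R"
      unfolding car by blast
    moreover from this have "a \<otimes> c \<in> Units R" "a \<otimes> d \<oplus> b \<in> carrier R"
      by auto
    ultimately show ?thesis
      unfolding car using AGL1_mult by auto
  qed
  show "x \<otimes>\<^bsub>AGL1 R\<^esub> y \<otimes>\<^bsub>AGL1 R\<^esub> z = x \<otimes>\<^bsub>AGL1 R\<^esub> (y \<otimes>\<^bsub>AGL1 R\<^esub> z)"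
    if "x \<in> carrier (AGL1 R)" "y \<in> carrier (AGL1 R)" "z \<in> carrier (AGL1 R)" for x y z
  proof -
    have "carrier (AGL1 R) \<subseteq> carrier (BijGroup (carrier R))"
      unfolding car by (auto simp: BijGroup_def affine_map_in_Bij)
    then show ?thesis
      using that monoid.m_assoc [OF group.is_monoid [OF group_BijGroup], of x "carrier R" y z]
      by (auto simp: AGL1_def)
  qed
  show "\<one>\<^bsub>AGL1 R\<^esub> \<otimes>\<^bsub>AGL1 R\<^esub> x = x" if "x \<in> carrier (AGL1 R)" for x
    using that unfolding car one by (auto simp: AGL1_mult Units_closed)
  show "\<exists>y\<in>carrier (AGL1 R). y \<otimes>\<^bsub>AGL1 R\<^esub> x = \<one>\<^bsub>AGL1 R\<^esub>" if "x \<in> carrier (AGL1 R)" for x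
  proof -
    from that obtain a b where x: "x = affine_map R a b" "a \<in> Units R" "b \<in> carrier R"
      unfolding car by blast
    let ?y = "affine_map R (inv a) (\<ominus> (inv a \<otimes> b))"
    have "?y \<otimes>\<^bsub>AGL1 R\<^esub> x = \<one>\<^bsub>AGL1 R\<^esub>"
      using x by (simp add: AGL1_mult one r_neg)
    moreover have "?y \<in> carrier (AGL1 R)"
      unfolding car using x by blast
    ultimately show ?thesis by blast
  qed
qed

end

theory Submission
  imports Defs
begin

text \<open>
  The maps \<open>x \<mapsto> a x + b\<close> and \<open>x \<mapsto> c x + d\<close> commute iff \<open>(a - 1) d = (c - 1) b\<close>, i.e. iff the
  vectors \<open>(a - 1, b)\<close> and \<open>(c - 1, d)\<close> have zero determinant.

  If \<open>n = A B\<close> with \<open>A, B > 2\<close> coprime, let \<open>\<epsilon>\<close> be the idempotent that is \<open>1\<close> modulo \<open>A\<close> and \<open>0\<close>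
  modulo \<open>B\<close>, and \<open>\<delta> = 1 - \<epsilon>\<close>. The pairs \<open>(1 - 2\<epsilon>, 0), (1, \<epsilon>)\<close> and \<open>(1 - 2\<delta>, 0), (1, \<delta>)\<close> form
  a square.

  If \<open>n\<close> is a prime power or twice one, then divisibility modulo \<open>n\<close> is total on the numbers
  \<open>u = a - 1\<close> with \<open>a\<close> a unit. So for any quadruple, one of the four numbers \<open>u\<close>, say that of \<open>F\<^sub>0\<close>,
  divides those of \<open>G\<^sub>0\<close> and \<open>G\<^sub>1\<close>; as \<open>F\<^sub>0\<close> commutes with \<open>G\<^sub>0\<close> and \<open>G\<^sub>1\<close>, these two then commute.
\<close>

section \<open>Commutation of affine maps as integer divisibility\<close>

lemma (in cring) affine_map_eq_iff:
  assumes "a \<in> carrier R" "b \<in> carrier R" "c \<in> carrier R" "d \<in> carrier R"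
  shows "affine_map R a b = affine_map R c d \<longleftrightarrow> a = c \<and> b = d"
proof
  assume eq: "affine_map R a b = affine_map R c d"
  \<comment> \<open>An affine map is recovered from its values at 0 and 1.\<close>
  have "b = d"
    using fun_cong [OF eq, of \<zero>] assms by (simp add: affine_map_def)
  moreover have "a \<oplus> b = c \<oplus> d"
    using fun_cong [OF eq, of \<one>] assms by (simp add: affine_map_def)
  ultimately show "a = c \<and> b = d"
    using assms by simp
qed simp

lemma carrier_AGL1:
  "carrier (AGL1 R) = {affine_map R a b | a b. a \<in> Units R \<and> b \<in> carrier R}"
  by (simp add: AGL1_def)

lemma (in cring) AGL1_commute_iff:
  assumes "a \<in> Units R" "b \<in> carrier R" "c \<in> Units R" "d \<in> carrier R"
  shows "affine_map R a b \<otimes>\<^bsub>AGL1 R\<^esub> affine_map R c d = affine_map R c d \<otimes>\<^bsub>AGL1 R\<^esub> affine_map R a b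
    \<longleftrightarrow> a \<otimes> d \<oplus> b = c \<otimes> b \<oplus> d"
  using assms by (simp add: AGL1_mult affine_map_eq_iff Units_closed m_comm)

context residues
begin

text \<open>Reducing the coefficients here lets arbitrary integers stand for residues, so that
  commutation becomes a divisibility statement about integers.\<close>

definition res_affine :: "int \<Rightarrow> int \<Rightarrow> int \<Rightarrow> int" where
  "res_affine a b = affine_map R (a mod m) (b mod m)"

lemma mod_in_Units:
  assumes "coprime a m"
  shows "a mod m \<in> Units R"
proof -
  have "coprime (a mod m) m"
    using assms m_gt_one by simp
  moreover from this have "a mod m \<noteq> 0"
    using m_gt_one by auto
  ultimately show ?thesis
    using m_gt_one by (simp add: res_units_eq order_le_neq_trans)
qed

lemma carrier_AGL1_residue: "carrier (AGL1 R) = {res_affine a b | a b. coprime a m}"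
proof (intro equalityI subsetI)
  fix f assume "f \<in> carrier (AGL1 R)"
  then obtain a b where ab: "f = affine_map R a b" "a \<in> Units R" "b \<in> carrier R"
    unfolding carrier_AGL1 by blast
  then have "f = res_affine a b" "coprime a m"
    by (auto simp: res_affine_def res_units_eq res_carrier_eq)
  then show "f \<in> {res_affine a b | a b. coprime a m}"
    by blast
next
  fix f assume "f \<in> {res_affine a b | a b. coprime a m}"
  then show "f \<in> carrier (AGL1 R)"
    unfolding carrier_AGL1 res_affine_def using mod_in_Units mod_in_carrier by blast
qed

lemma res_affine_commute_iff:
  assumes "coprime a m" "coprime c m"
  shows "res_affine a b \<otimes>\<^bsub>AGL1 R\<^esub> res_affine c d = res_affine c d \<otimes>\<^bsub>AGL1 R\<^esub> res_affine a b
    \<longleftrightarrow> m dvd (a - 1) * d - (c - 1) * b"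
proof -
  have "res_affine a b \<otimes>\<^bsub>AGL1 R\<^esub> res_affine c d = res_affine c d \<otimes>\<^bsub>AGL1 R\<^esub> res_affine a b
    \<longleftrightarrow> (a * d + b) mod m = (c * b + d) mod m"
    using assms mod_in_Units
    by (simp add: res_affine_def AGL1_commute_iff res_mult_eq res_add_eq mod_simps)
  also have "\<dots> \<longleftrightarrow> m dvd (a - 1) * d - (c - 1) * b"
    by (simp add: mod_eq_dvd_iff algebra_simps)
  finally show ?thesis .
qed

section \<open>Construction of a square from two coprime factors\<close>

lemma square_if_coprime_factors:
  assumes "m = A * B" "coprime A B" "A > 2" "B > 2"
  shows "\<exists>Q. cross_commuting_nonabelian_square (AGL1 R) Q"
proof -
  obtain \<epsilon> where eps: "[\<epsilon> = 1] (mod A)" "[\<epsilon> = 0] (mod B)"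
    using binary_chinese_remainder_int [OF \<open>coprime A B\<close>] by blast
  define \<delta> where "\<delta> = 1 - \<epsilon>"
  have A: "A dvd \<delta>" and B: "B dvd \<epsilon>"
    using eps by (auto simp: \<delta>_def cong_iff_dvd_diff dvd_diff_commute)
  have prod: "m dvd \<epsilon> * \<delta>"
    using mult_dvd_mono [OF B A] assms(1) by (simp add: mult.commute)
  \<comment> \<open>As \<open>x\<close> is idempotent modulo \<open>m\<close>,
    \<open>1 - 2 * x\<close> is its own inverse: its square minus 1 is
    \<open>- 4 * (x * (1 - x))\<close>.\<close>
  have unit: "coprime (1 - 2 * x) m" if "m dvd x * (1 - x)" for x
  proof -
    have "[(1 - 2 * x) * (1 - 2 * x) = 1] (mod m)"
      using dvd_mult [OF that, of "- 4"] by (simp add: cong_iff_dvd_diff algebra_simps)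
    then show ?thesis
      using coprime_iff_invertible_int by blast
  qed
  \<comment> \<open>Up to sign, \<open>2 * x * x\<close> is the determinant deciding whether
    \<open>res_affine (1 - 2 * x) 0\<close> and \<open>res_affine 1 x\<close> commute. Modulo
    \<open>C\<close> it is 2, since \<open>x\<close> is 1 there; the multiple of
    \<open>1 - x\<close> added below turns it into exactly 2.\<close>
  have not_dvd: "\<not> m dvd 2 * x * x" if "C dvd m" "C > 2" "C dvd 1 - x" for C x
  proof
    assume "m dvd 2 * x * x"
    with that have "C dvd 2 * x * x + 2 * (1 + x) * (1 - x)"
      by (meson dvd_add dvd_mult dvd_trans)
    then have "C dvd 2"
      by (simp add: algebra_simps)
    then show False
      using \<open>C > 2\<close> zdvd_imp_le by fastforce
  qed
  have units: "coprime (1 - 2 * \<epsilon>) m" "coprime (1 - 2 * \<delta>) m"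
    using unit [of \<epsilon>] unit [of \<delta>] prod by (simp_all add: \<delta>_def mult.commute)
  have nonzero: "\<not> m dvd 2 * \<epsilon> * \<epsilon>" "\<not> m dvd 2 * \<delta> * \<delta>"
    using not_dvd [of A \<epsilon>] not_dvd [of B \<delta>] assms A B by (auto simp: \<delta>_def)
  \<comment> \<open>Up to sign, the cross determinants of a linear map from one pair and a
    translation from the other; the other two cross determinants are 0.\<close>
  have cross: "m dvd 2 * \<epsilon> * \<delta>" "m dvd 2 * \<delta> * \<epsilon>"
    using prod by (simp_all add: mult.assoc mult.commute [of \<delta>])
  have "cross_commuting_nonabelian_square (AGL1 R)
    (res_affine (1 - 2 * \<epsilon>) 0, res_affine 1 \<epsilon>, res_affine (1 - 2 * \<delta>) 0, res_affine 1 \<delta>)"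
    using units nonzero cross
    by (auto simp: cross_commuting_nonabelian_square_def res_affine_commute_iff carrier_AGL1_residue)
  then show ?thesis ..
qed

end

section \<open>Obstruction from total divisibility modulo \<open>m\<close>\<close>

lemma dvd_det_if_gcd_dvd:
  fixes m u b v0 d0 v1 d1 :: int
  assumes "gcd u m dvd v0" "gcd u m dvd v1"
    and "m dvd u * d0 - v0 * b" "m dvd u * d1 - v1 * b"
  shows "m dvd v0 * d1 - v1 * d0"
proof -
  \<comment> \<open>By Bezout, the gcd condition makes \<open>v\<close> a multiple of
    \<open>u\<close> modulo \<open>m\<close>. This replaces cancelling \<open>u\<close>, which may
    be a zero divisor.\<close>
  have "\<exists>w. m dvd v - u * w" if dvd: "gcd u m dvd v" for v
  proof -
    obtain k where v: "v = gcd u m * k"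
      using dvd by (rule dvdE)
    obtain x y where bezout: "x * u + y * m = gcd u m"
      using bezout_int by blast
    have "v - u * (x * k) = m * (y * k)"
      unfolding v bezout [symmetric] by (simp add: algebra_simps)
    then show ?thesis
      by (metis dvd_triv_left)
  qed
  then obtain w0 w1 where w: "m dvd v0 - u * w0" "m dvd v1 - u * w1"
    using assms by meson
  \<comment> \<open>Modulo \<open>m\<close>, \<open>v0 * d1 - v1 * d0\<close> is
    \<open>w0 * u * d1 - w1 * u * d0\<close>, then \<open>b * (w0 * v1 - w1 * v0)\<close>, then 0.
    In the identity every summand contains terms already known to be divisible by
    \<open>m\<close>.\<close>
  have "v0 * d1 - v1 * d0 =
      (v0 - u * w0) * (d1 - w1 * b) - (v1 - u * w1) * (d0 - w0 * b)
      + w0 * (u * d1 - v1 * b) - w1 * (u * d0 - v0 * b)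
      + b * w1 * (v0 - u * w0) - b * w0 * (v1 - u * w1)
      + b * (w0 * (v1 - u * w1) - w1 * (v0 - u * w0))"
    by (simp add: algebra_simps)
  then show ?thesis
    using w assms(3,4) by (simp add: dvd_add dvd_diff)
qed

text \<open>Both gcds are powers of \<open>r\<close>, and these form a chain under
  divisibility.\<close>

lemma gcd_dvd_total_prime_power:
  fixes r u v :: int
  assumes "prime r"
  shows "gcd u (r ^ i) dvd v \<or> gcd v (r ^ i) dvd u"
proof -
  have "\<exists>j. gcd x (r ^ i) = r ^ j" for x
    using divides_primepow [OF \<open>prime r\<close> gcd_dvd2] by (metis normalize_gcd)
  then obtain j k where "gcd u (r ^ i) = r ^ j" "gcd v (r ^ i) = r ^ k"
    by metis
  then show ?thesis
    by (metis dvd_trans gcd_dvd1 le_imp_power_dvd nat_le_linear)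
qed

text \<open>Evenness lets the factor 2 cancel, which leaves the prime power case. For odd
  \<open>r\<close> and positive \<open>i\<close>, totality fails at \<open>u = 2\<close>,
  \<open>v = r\<close>.\<close>

lemma gcd_dvd_total_twice_prime_power:
  fixes r u v :: int
  assumes "prime r" "even u" "even v"
  shows "gcd u (2 * r ^ i) dvd v \<or> gcd v (2 * r ^ i) dvd u"
proof -
  obtain x y where "u = 2 * x" "v = 2 * y"
    using assms(2,3) by (elim evenE)
  then show ?thesis
    using gcd_dvd_total_prime_power [OF \<open>prime r\<close>, of x i y] by (simp add: gcd_mult_left)
qed

lemma (in residues) no_square_if_gcd_dvd_total:
  assumes total: "\<And>a c. coprime a m \<Longrightarrow> coprime c m \<Longrightarrow>
      gcd (a - 1) m dvd c - 1 \<or> gcd (c - 1) m dvd a - 1"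
  shows "\<not> cross_commuting_nonabelian_square (AGL1 R) Q"
proof
  assume sq: "cross_commuting_nonabelian_square (AGL1 R) Q"
  obtain F0 F1 G0 G1 where Q: "Q = (F0, F1, G0, G1)"
    by (cases Q)
  have in_carrier: "F0 \<in> carrier (AGL1 R)" "F1 \<in> carrier (AGL1 R)"
      "G0 \<in> carrier (AGL1 R)" "G1 \<in> carrier (AGL1 R)"
    using sq by (simp_all add: Q cross_commuting_nonabelian_square_def)
  obtain a0 b0 a1 b1 c0 d0 c1 d1 where
    eqs: "F0 = res_affine a0 b0" "F1 = res_affine a1 b1" "G0 = res_affine c0 d0" "G1 = res_affine c1 d1"
    and units: "coprime a0 m" "coprime a1 m" "coprime c0 m" "coprime c1 m"
    using in_carrier unfolding carrier_AGL1_residue mem_Collect_eq by (elim exE conjE)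
  have comm: "m dvd (a0 - 1) * d0 - (c0 - 1) * b0" "m dvd (a0 - 1) * d1 - (c1 - 1) * b0"
      "m dvd (a1 - 1) * d0 - (c0 - 1) * b1" "m dvd (a1 - 1) * d1 - (c1 - 1) * b1"
    and noncomm: "\<not> m dvd (a0 - 1) * b1 - (a1 - 1) * b0" "\<not> m dvd (c0 - 1) * d1 - (c1 - 1) * d0"
    using sq units
    by (auto simp: Q eqs cross_commuting_nonabelian_square_def res_affine_commute_iff)
  \<comment> \<open>The same relations with the roles of the two pairs exchanged.\<close>
  have comm': "m dvd (c0 - 1) * b0 - (a0 - 1) * d0" "m dvd (c1 - 1) * b0 - (a0 - 1) * d1"
      "m dvd (c0 - 1) * b1 - (a1 - 1) * d0" "m dvd (c1 - 1) * b1 - (a1 - 1) * d1"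
    using comm by (simp_all add: dvd_diff_commute)
  \<comment> \<open>\<open>le a c\<close> means that \<open>c - 1\<close> is a multiple of
    \<open>a - 1\<close> modulo \<open>m\<close>; on units this is a total preorder.\<close>
  define le where "le a c \<longleftrightarrow> gcd (a - 1) m dvd c - 1" for a c
  have trans: "le a d" if "le a c" "le c d" for a c d
    using that unfolding le_def by (meson dvd_trans gcd_dvd2 gcd_greatest)
  have lin: "le a c \<or> le c a" if "coprime a m" "coprime c m" for a c
    using total that by (simp add: le_def)
  have "\<not> (le a0 c0 \<and> le a0 c1)" "\<not> (le a1 c0 \<and> le a1 c1)"
    unfolding le_def using dvd_det_if_gcd_dvd comm noncomm by blast+
  moreover have "\<not> (le c0 a0 \<and> le c0 a1)" "\<not> (le c1 a0 \<and> le c1 a1)"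
    unfolding le_def using dvd_det_if_gcd_dvd comm' noncomm by blast+
  \<comment> \<open>A least element among \<open>a0\<close>, \<open>a1\<close>, \<open>c0\<close>,
    \<open>c1\<close> lies below both members of the opposite pair, which was just excluded.\<close>
  ultimately show False
    using lin units trans by metis
qed

lemma (in residues) no_square_prime_power:
  assumes "prime r" "m = r ^ i"
  shows "\<not> cross_commuting_nonabelian_square (AGL1 R) Q"
  by (rule no_square_if_gcd_dvd_total) (simp add: assms gcd_dvd_total_prime_power)

lemma (in residues) no_square_twice_prime_power:
  assumes "prime r" "m = 2 * r ^ i"
  shows "\<not> cross_commuting_nonabelian_square (AGL1 R) Q"
proof (rule no_square_if_gcd_dvd_total)
  fix a c assume "coprime a m" "coprime c m"
  then have "even (a - 1)" "even (c - 1)"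
    using assms(2) by auto
  then show "gcd (a - 1) m dvd c - 1 \<or> gcd (c - 1) m dvd a - 1"
    unfolding \<open>m = 2 * r ^ i\<close> by (rule gcd_dvd_total_twice_prime_power [OF \<open>prime r\<close>])
qed

section \<open>Counting the prime-power factors greater than 2\<close>

lemma primepow_or_twice_if_card_less_2:
  fixes n t :: nat and p e :: "nat \<Rightarrow> nat"
  assumes "n \<ge> 2"
    and p: "\<And>k. k \<in> {1..t} \<Longrightarrow> prime (p k)"
    and inj: "inj_on p {1..t}"
    and e: "\<And>k. k \<in> {1..t} \<Longrightarrow> e k \<ge> 1"
    and n: "n = (\<Prod>k = 1..t. p k ^ e k)"
    and card: "card {k \<in> {1..t}. p k ^ e k > 2} < 2"
  shows "primepow n \<or> (\<exists>q. primepow q \<and> odd q \<and> n = 2 * q)"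
proof -
  define S T where "S = {k \<in> {1..t}. p k ^ e k > 2}" and "T = {1..t} - S"
  have sub: "S \<subseteq> {1..t}"
    by (auto simp: S_def)
  have pp: "primepow (p k ^ e k)" if "k \<in> {1..t}" for k
    using p [OF that] e [OF that] unfolding primepow_def by (metis less_le_trans zero_less_one)
  \<comment> \<open>A factor that is at most 2 must be 2 to the power 1; as the primes are distinct,
    it occurs at most once.\<close>
  have two: "p k = 2" "p k ^ e k = 2" if "k \<in> T" for k
  proof -
    have k: "k \<in> {1..t}" "p k ^ e k \<le> 2"
      using that by (auto simp: T_def S_def)
    have "p k \<le> p k ^ e k"
      using e [OF k(1)] prime_gt_0_nat [OF p [OF k(1)]] by (simp add: self_le_power)
    then show "p k = 2" "p k ^ e k = 2"
      using k(2) prime_ge_2_nat [OF p [OF k(1)]] by linarith+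
  qed
  have "card T \<le> 1"
  proof -
    have "inj_on p T"
      using inj by (rule inj_on_subset) (auto simp: T_def)
    moreover have "p ` T \<subseteq> {2}"
      using two by auto
    ultimately show ?thesis
      using card_inj_on_le [of p T "{2}"] by simp
  qed
  moreover have "finite T" "finite S" "card S \<le> 1"
    using card by (auto simp: T_def S_def)
  ultimately have T: "T = {} \<or> (\<exists>i. T = {i})" and S: "S = {} \<or> (\<exists>j. S = {j})"
    by (auto simp: le_Suc_eq card_1_singleton_iff)
  have prod: "n = (\<Prod>k\<in>T. p k ^ e k) * (\<Prod>k\<in>S. p k ^ e k)"
    unfolding n T_def by (rule prod.subset_diff [OF sub]) simp
  show ?thesis
  proof (cases "S = {}")
    case True
    \<comment> \<open>With \<open>T\<close> empty as well, the product would be 1, against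
      \<open>n \<ge> 2\<close>.\<close>
    then have "n = 2"
      using T prod two \<open>n \<ge> 2\<close> by auto
    then show ?thesis
      by simp
  next
    case False
    then obtain j where j: "S = {j}"
      using S by blast
    then have "j \<in> {1..t}"
      using sub by blast
    show ?thesis
    proof (cases "T = {}")
      case True
      then show ?thesis
        using prod j pp [OF \<open>j \<in> {1..t}\<close>] by simp
    next
      case False
      then obtain i where i: "T = {i}"
        using T by blast
      then have "i \<in> {1..t}" "i \<noteq> j"
        using j unfolding T_def by blast+
      then have "p j \<noteq> 2"
        using inj two(1) [of i] i \<open>j \<in> {1..t}\<close> by (metis inj_onD insertI1)
      then have "odd (p j ^ e j)"
        using p [OF \<open>j \<in> {1..t}\<close>] by (metis even_power primes_dvd_imp_eq two_is_prime_nat)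
      then show ?thesis
        using prod i j two(2) [of i] pp [OF \<open>j \<in> {1..t}\<close>] by auto
    qed
  qed
qed

text \<open>One large factor serves as \<open>A\<close> and the product of all others as
  \<open>B\<close>; a second large factor divides \<open>B\<close>.\<close>

lemma coprime_factors_if_card_ge_2:
  fixes t :: nat and p e :: "nat \<Rightarrow> nat"
  assumes p: "\<And>k. k \<in> {1..t} \<Longrightarrow> prime (p k)"
    and inj: "inj_on p {1..t}"
    and card: "card {k \<in> {1..t}. p k ^ e k > 2} \<ge> 2"
  obtains A B where "(\<Prod>k = 1..t. p k ^ e k) = A * B" "coprime A B" "A > 2" "B > 2"
proof -
  obtain i j where ij: "i \<in> {1..t}" "j \<in> {1..t}" "i \<noteq> j" "p i ^ e i > 2" "p j ^ e j > 2"
  proof -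
    obtain K where K: "K \<subseteq> {k \<in> {1..t}. p k ^ e k > 2}" "card K = 2"
      using card by (rule obtain_subset_with_card_n)
    from \<open>card K = 2\<close> obtain i j where "K = {i, j}" "i \<noteq> j"
      unfolding card_2_iff by blast
    then show thesis
      using that [of i j] K(1) by simp
  qed
  let ?B = "\<Prod>k\<in>{1..t} - {i}. p k ^ e k"
  have "coprime (p i ^ e i) ?B"
  proof (rule prod_coprime_right)
    fix k assume "k \<in> {1..t} - {i}"
    then have "p i \<noteq> p k" "prime (p k)"
      using inj ij(1) p by (auto dest: inj_onD)
    then show "coprime (p i ^ e i) (p k ^ e k)"
      using p [OF ij(1)] primes_coprime by auto
  qed
  moreover have "?B > 2"
  proof -
    have "p j ^ e j dvd ?B"
      using ij by (intro dvd_prodI) auto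
    moreover have "?B > 0"
      using p by (intro prod_pos) (auto simp: prime_gt_0_nat)
    ultimately show ?thesis
      using dvd_imp_le [of "p j ^ e j" ?B] ij(5) by linarith
  qed
  moreover have "(\<Prod>k = 1..t. p k ^ e k) = p i ^ e i * ?B"
    using ij(1) by (intro prod.remove) auto
  ultimately show thesis
    using that ij(4) by blast
qed

theorem corollary5p1:
  fixes n t :: nat and p e :: "nat \<Rightarrow> nat"
  assumes "n \<ge> 2"
    and "\<And>k. k \<in> {1..t} \<Longrightarrow> prime (p k)"
    and "inj_on p {1..t}"
    and "\<And>k. k \<in> {1..t} \<Longrightarrow> e k \<ge> 1"
    and "n = (\<Prod>k = 1..t. p k ^ e k)"
  shows "((\<exists>Q. cross_commuting_nonabelian_square (AGL1 (residue_ring (int n))) Q) \<longleftrightarrow>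
            card {k \<in> {1..t}. p k ^ e k > 2} \<ge> 2) \<and>
         (card {k \<in> {1..t}. p k ^ e k > 2} \<ge> 2 \<longleftrightarrow>
            \<not> primepow n \<and> \<not> (\<exists>q. primepow q \<and> odd q \<and> n = 2 * q))"
    (is "(?square \<longleftrightarrow> ?factors) \<and> (?factors \<longleftrightarrow> ?nonpow)")
proof -
  interpret residues "int n" "residue_ring (int n)"
    using \<open>n \<ge> 2\<close> by unfold_locales simp_all
  \<comment> \<open>Both equivalences follow from a cycle of three implications.\<close>
  have "?factors \<Longrightarrow> ?square"
  proof -
    assume ?factors
    then obtain A B where "n = A * B" "coprime A B" "A > 2" "B > 2"
      using coprime_factors_if_card_ge_2 [OF assms(2,3)] unfolding assms(5) by blast
    then show ?square
      by (intro square_if_coprime_factors [of "int A" "int B"]) simp_all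
  qed
  moreover have "?square \<Longrightarrow> ?nonpow"
  proof -
    assume sq: ?square
    have "\<not> primepow n"
    proof
      assume "primepow n"
      then obtain r k where "prime r" "n = r ^ k"
        by (auto simp: primepow_def)
      then show False
        using sq no_square_prime_power [of "int r" k] by auto
    qed
    moreover have "\<not> (primepow q \<and> n = 2 * q)" for q
    proof
      assume "primepow q \<and> n = 2 * q"
      then obtain r k where "prime r" "n = 2 * r ^ k"
        by (auto simp: primepow_def)
      then show False
        using sq no_square_twice_prime_power [of "int r" k] by auto
    qed
    ultimately show ?nonpow
      by blast
  qed
  moreover have "?nonpow \<Longrightarrow> ?factors"
    using primepow_or_twice_if_card_less_2 [OF assms] by (meson not_less)
  ultimately show ?thesis
    by blast
qed

end
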